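(* Let $d\ge 2$ and let $K=\sum_{e\in E_K} w_e\,\mathbf b_e\mathbf b_e^\top$ be a $d\times d$ weighted graph Laplacian with weights $w_e>0$ whose support graph $([d],E_K)$ is connected. For every probability distribution $\mathcal D$ on the spanning trees of $([d],E_K)$ whose edge marginals $p_e=\mathbb P_{T\sim\mathcal D}(e\in T)$ satisfy $p_e>0$ for all $e\in E_K$, one has $R_K(\mathcal D)\ge 1$, with equality if and only if $p_e=\tau_e$ for every $e\in E_K$. In particular, the weighted random spanning-tree distribution of $K$, whose edge marginals satisfy $p_e=\tau_e$ for every $e\in E_K$, minimizes $R_K(\mathcal D)$ over all such distributions $\mathcal D$ (i.e. it is locally minimax-optimal among unbiased inverse-marginal one-tree estimators), attaining $R_K=1$.
   Context: Graphs are simple and undirected on vertex set $[d]=\{1,\dots,d\}$. For an (arbitrarily oriented) edge $e=(u,v)$, $\mathbf b_e=\mathbf e_u-\mathbf e_v\in\mathbb R^d$, where $\mathbf e_u$ is the standard basis vector. $K^+$ is the Moore--Penrose pseudoinverse and $K^{+/2}=(K^+)^{1/2}$. The leverage score of $e\in E_K$ is $\tau_e=w_e\,\mathbf b_e^\top K^+\mathbf b_e$. For a distribution $\mathcal D$ on spanning trees of $([d],E_K)$ with all marginals $p_e>0$, the inverse-marginal one-tree estimator is $\widehat K_{\mathcal D}(T)=\sum_{e\in T}\frac{w_e}{p_e}\mathbf b_e\mathbf b_e^\top$ with $T\sim\mathcal D$; it is unbiased, $\mathbb E[\widehat K_{\mathcal D}(T)]=K$. Its local risk is $$R_K(\mathcal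 D)=\max_{e\in E_K}\left\lVert K^{+/2}\left(\frac{w_e}{p_e}\mathbf b_e\mathbf b_e^\top\right)K^{+/2}\right\rVert=\max_{e\in E_K}\frac{\tau_e}{p_e},$$ where $\|\cdot\|$ is the spectral norm. The weighted random spanning-tree distribution of $K$ is the distribution on spanning trees of $([d],E_K)$ with $\mathbb P(T)\propto\prod_{e\in T}w_e$. *)

theory Defs
  imports "HOL-Analysis.Analysis" "HOL-Probability.Probability_Mass_Function"
begin

(* Simple undirected graphs on the vertex set UNIV :: 'n set, given by their set of edges;
   an edge is a two-element set of vertices. *)

definition simple_graph :: "'n set set \<Rightarrow> bool" where
  "simple_graph E \<longleftrightarrow> (\<forall>e\<in>E. card e = 2)"

definition connected_graph :: "'n set set \<Rightarrow> bool" where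
  "connected_graph E \<longleftrightarrow> (\<forall>u v. (u, v) \<in> {(x, y). {x, y} \<in> E}\<^sup>*)"

definition is_cycle :: "'n set set \<Rightarrow> 'n list \<Rightarrow> bool" where
  "is_cycle F xs \<longleftrightarrow> length xs \<ge> 3 \<and> distinct xs \<and>
     (\<forall>i<length xs. {xs ! i, xs ! (Suc i mod length xs)} \<in> F)"

definition tree_graph :: "'n set set \<Rightarrow> bool" where
  "tree_graph F \<longleftrightarrow> simple_graph F \<and> connected_graph F \<and> (\<nexists>xs. is_cycle F xs)"

(* Connectedness refers to all of UNIV, so such a tree is spanning; it is identified with its
   edge set. *)
definition spanning_trees :: "'n set set \<Rightarrow> 'n set set set" where
  "spanning_trees E = {T. T \<subseteq> E \<and> tree_graph T}"

definition orientation :: "'n set set \<Rightarrow> ('n set \<Rightarrow> 'n \<times> 'n) \<Rightarrow> bool" where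
  "orientation E ori \<longleftrightarrow> (\<forall>e\<in>E. e = {fst (ori e), snd (ori e)})"

definition edge_vec :: "('n set \<Rightarrow> 'n \<times> 'n) \<Rightarrow> 'n set \<Rightarrow> real^'n::finite" where
  "edge_vec ori e = axis (fst (ori e)) 1 - axis (snd (ori e)) 1"

(* The type annotation makes the factors an n x 1 and a 1 x n matrix: columnvector and rowvector
   leave the other dimension open. *)
definition edge_mat :: "('n set \<Rightarrow> 'n \<times> 'n) \<Rightarrow> 'n set \<Rightarrow> real^'n^'n::finite" where
  "edge_mat ori e = (columnvector (edge_vec ori e) :: real^1^'n) ** rowvector (edge_vec ori e)"

definition laplacian ::
    "'n set set \<Rightarrow> ('n set \<Rightarrow> real) \<Rightarrow> ('n set \<Rightarrow> 'n \<times> 'n) \<Rightarrow> real^'n^'n::finite" where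
  "laplacian E w ori = (\<Sum>e\<in>E. w e *\<^sub>R edge_mat ori e)"

(* Moore-Penrose pseudoinverse, as the unique solution of the four Penrose equations. *)
definition pinv :: "real^'n^'n \<Rightarrow> real^'n^'n::finite" where
  "pinv A = (THE X. A ** X ** A = A \<and> X ** A ** X = X \<and>
     transpose (A ** X) = A ** X \<and> transpose (X ** A) = X ** A)"

definition pos_semidef :: "real^'n^'n::finite \<Rightarrow> bool" where
  "pos_semidef A \<longleftrightarrow> transpose A = A \<and> (\<forall>x. 0 \<le> x \<bullet> (A *v x))"

(* The unique positive semidefinite square root; meaningful for positive semidefinite A only. *)
definition psd_sqrt :: "real^'n^'n \<Rightarrow> real^'n^'n::finite" where
  "psd_sqrt A = (THE S. pos_semidef S \<and> S ** S = A)"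

definition spectral_norm :: "real^'n^'n::finite \<Rightarrow> real" where
  "spectral_norm A = onorm ((*v) A)"

definition leverage ::
    "'n set set \<Rightarrow> ('n set \<Rightarrow> real) \<Rightarrow> ('n set \<Rightarrow> 'n \<times> 'n) \<Rightarrow> 'n::finite set \<Rightarrow> real" where
  "leverage E w ori e =
     w e * (edge_vec ori e \<bullet> (pinv (laplacian E w ori) *v edge_vec ori e))"

definition marginal :: "'n set set pmf \<Rightarrow> 'n set \<Rightarrow> real" where
  "marginal D e = measure_pmf.prob D {T. e \<in> T}"

definition admissible :: "'n set set \<Rightarrow> 'n set set pmf \<Rightarrow> bool" where
  "admissible E D \<longleftrightarrow> set_pmf D \<subseteq> spanning_trees E \<and> (\<forall>e\<in>E. marginal D e > 0)"

definition local_risk ::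
    "'n set set \<Rightarrow> ('n set \<Rightarrow> real) \<Rightarrow> ('n set \<Rightarrow> 'n \<times> 'n) \<Rightarrow> 'n::finite set set pmf \<Rightarrow> real" where
  "local_risk E w ori D =
     (let R = psd_sqrt (pinv (laplacian E w ori)) in
      Max ((\<lambda>e. spectral_norm (R ** ((w e / marginal D e) *\<^sub>R edge_mat ori e) ** R)) ` E))"

definition tree_weight :: "('n set \<Rightarrow> real) \<Rightarrow> 'n set set \<Rightarrow> real" where
  "tree_weight w T = (\<Prod>e\<in>T. w e)"

(* embed_pmf turns a nonnegative mass function of total mass 1 into a pmf; see the lemma below. *)
definition weighted_rst :: "'n::finite set set \<Rightarrow> ('n set \<Rightarrow> real) \<Rightarrow> 'n set set pmf" where
  "weighted_rst E w = embed_pmf (\<lambda>T. if T \<in> spanning_trees E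
     then tree_weight w T / (\<Sum>T'\<in>spanning_trees E. tree_weight w T') else 0)"

lemma pmf_weighted_rst:
  fixes E :: "'n::finite set set"
  assumes pos: "\<And>e. e \<in> E \<Longrightarrow> w e > 0" and ne: "spanning_trees E \<noteq> {}"
  shows "pmf (weighted_rst E w) T = (if T \<in> spanning_trees E
    then tree_weight w T / (\<Sum>T'\<in>spanning_trees E. tree_weight w T') else 0)"
proof -
  let ?Z = "\<Sum>T'\<in>spanning_trees E. tree_weight w T'"
  let ?f = "\<lambda>T. if T \<in> spanning_trees E then tree_weight w T / ?Z else 0"
  have tw: "tree_weight w T > 0" if "T \<in> spanning_trees E" for T
    unfolding tree_weight_def using that pos
    by (intro prod_pos) (auto simp: spanning_trees_def)
  have Z: "?Z > 0"
    using ne tw by (intro sum_pos) auto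
  have nn: "0 \<le> ?f T" for T
    using tw[of T] Z by auto
  have "(\<Sum>T\<in>UNIV. ?f T) = (\<Sum>T\<in>spanning_trees E. tree_weight w T / ?Z)"
    by (simp add: sum.If_cases)
  also have "\<dots> = 1"
    using Z by (simp flip: sum_divide_distrib)
  finally have "(\<Sum>T\<in>UNIV. ?f T) = 1" .
  then have "(\<integral>\<^sup>+T. ennreal (?f T) \<partial>count_space UNIV) = 1"
    using nn by (simp add: nn_integral_count_space_finite sum_ennreal del: sum.If_cases)
  then show ?thesis
    unfolding weighted_rst_def using nn by (subst pmf_embed_pmf) auto
qed

end

(* The rank-one norm is |R b|^2 with R^2 = K^+, so the local risk is max_e tau_e / p_e. Every spanning
   tree has the same number of edges, so sum_e p_e does not depend on the distribution; once the
   marginals of the weighted random spanning tree are known to be tau_e, this sum equals sum_e tau_e,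
   and families with equal sums have maximal ratio at least 1, with equality only if they agree.

   For the marginals, determinants are avoided. For an edge g and a set F such that F + g is a
   spanning tree, let p_{F,g} be the indicator vector of one side of the cut that F leaves, and put
   q_g = sum_F w(F) p_{F,g}. Basis exchange gives q_g . b_e = q_e . b_g, and expanding b_e along
   every spanning tree then gives K q_e = Z b_e, with Z the total weight of the spanning trees.
   Hence tau_e = w_e (q_e . b_e) / Z, which is the fraction of tree weight carried by the trees
   through e. *)

theory Submission
  imports Defs
begin

subsection \<open>Spectral theorem for symmetric matrices\<close>

text \<open>A maximiser of the Rayleigh quotient on the unit sphere of \<open>S\<close> is an
  eigenvector, and its orthogonal complement within \<open>S\<close> is again invariant. Stating the
  claim for invariant subspaces lets the induction on dimension descend to that complement.\<close>

lemma selfadjoint_orthonormal_eigenbasis: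
  fixes f :: "'a::euclidean_space \<Rightarrow> 'a"
  assumes lin: "linear f" and sa: "\<And>x y. f x \<bullet> y = x \<bullet> f y"
  shows "subspace S \<Longrightarrow> f ` S \<subseteq> S \<Longrightarrow>
    \<exists>B\<subseteq>S. pairwise orthogonal B \<and> (\<forall>v\<in>B. norm v = 1 \<and> (\<exists>c. f v = c *\<^sub>R v)) \<and> span B = S"
proof (induction "dim S" arbitrary: S rule: less_induct)
  case less
  show ?case
  proof (cases "S = {0}")
    case True
    then show ?thesis by (intro exI[of _ "{}"]) simp
  next
    case False
    let ?U = "S \<inter> sphere 0 1"
    obtain s where s: "s \<in> S" "s \<noteq> 0"
      using False subspace_0[OF less.prems(1)] by blast
    have "compact ?U"
      using closed_Int_compact[OF closed_subspace[OF less.prems(1)] compact_sphere] by blast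
    moreover have "(1 / norm s) *\<^sub>R s \<in> ?U"
      using s less.prems(1) by (auto simp: subspace_scale)
    moreover have "continuous_on ?U f"
      using lin by (simp add: linear_conv_bounded_linear linear_continuous_on)
    then have "continuous_on ?U (\<lambda>x. x \<bullet> f x)"
      by (intro continuous_on_inner continuous_on_id)
    ultimately obtain u where u: "u \<in> ?U" and umax: "\<And>y. y \<in> ?U \<Longrightarrow> y \<bullet> f y \<le> u \<bullet> f u"
      using continuous_attains_sup[of ?U "\<lambda>x. x \<bullet> f x"] by blast
    define l where "l = u \<bullet> f u"
    define r where "r = f u - l *\<^sub>R u"
    have uS: "u \<in> S" and uu: "u \<bullet> u = 1" and nu: "norm u = 1"
      using u by (auto simp: dot_square_norm)
    have rS: "r \<in> S"
      unfolding r_def using less.prems uS by (auto intro!: subspace_diff subspace_scale)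
    \<comment> \<open>By homogeneity the maximum on the unit sphere bounds the quadratic form on all
      of \<open>S\<close>.\<close>
    have ray: "x \<bullet> f x \<le> l * (x \<bullet> x)" if "x \<in> S" for x
    proof (cases "x = 0")
      case True
      then show ?thesis by simp
    next
      case False
      then have "(1 / norm x) *\<^sub>R x \<in> ?U"
        using that less.prems(1) by (auto simp: subspace_scale)
      from umax[OF this] have "(x \<bullet> f x) / (norm x)\<^sup>2 \<le> l"
        by (simp add: l_def linear_cmul[OF lin] power2_eq_square)
      then show ?thesis
        using False by (simp add: divide_simps dot_square_norm)
    qed
    have ur: "u \<bullet> r = 0"
      by (simp add: r_def inner_diff_right uu l_def)
    have rfu: "r \<bullet> f u = r \<bullet> r"
    proof -
      have "f u = r + l *\<^sub>R u" by (simp add: r_def)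
      then show ?thesis using ur by (simp add: inner_add_right inner_commute)
    qed
    define R where "R = r \<bullet> r"
    define C where "C = l * R - r \<bullet> f r"
    have C0: "C \<ge> 0" using ray[OF rS] by (simp add: C_def R_def)
    \<comment> \<open>First-order optimality of \<open>u\<close> in the direction of the residual \<open>r\<close>.\<close>
    have quad: "2 * t * R \<le> t\<^sup>2 * C" for t
    proof -
      have "u + t *\<^sub>R r \<in> S"
        using uS rS less.prems(1) by (simp add: subspace_add subspace_scale)
      from ray[OF this] have
        "u \<bullet> f u + t * (u \<bullet> f r) + t * (r \<bullet> f u) + t\<^sup>2 * (r \<bullet> f r) \<le> l * (1 + t\<^sup>2 * R)"
        using ur uu by (simp add: linear_add[OF lin] linear_cmul[OF lin] inner_add_left
            inner_add_right power2_eq_square R_def inner_commute algebra_simps)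
      moreover have "u \<bullet> f r = r \<bullet> f u"
        using sa[of u r] by (simp add: inner_commute)
      ultimately show ?thesis
        by (simp add: rfu R_def C_def l_def algebra_simps)
    qed
    have "R = 0"
    proof (rule ccontr)
      assume "R \<noteq> 0"
      then have R: "R > 0" by (simp add: R_def order_less_le)
      \<comment> \<open>The choice \<open>t = R / (C + 1)\<close> nearly minimises the quadratic in
        \<open>t\<close>; the added 1 keeps the denominator positive when
        \<open>C = 0\<close>.\<close>
      have "2 * R * R \<le> R * R * (C / (C + 1))"
        using quad[of "R / (C + 1)"] C0 by (simp add: power2_eq_square divide_simps)
      also have "\<dots> \<le> R * R * 1"
        using C0 by (intro mult_left_mono) auto
      finally show False using R by (simp add: mult_le_cancel_right)
    qed
    then have fu: "f u = l *\<^sub>R u" by (simp add: R_def r_def)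
    let ?S' = "S \<inter> {x. u \<bullet> x = 0}"
    have sub: "subspace ?S'"
      using less.prems(1) subspace_hyperplane by (rule subspace_inter)
    moreover have "f ` ?S' \<subseteq> ?S'"
    proof (rule image_subsetI)
      fix x assume "x \<in> ?S'"
      then show "f x \<in> ?S'"
        using less.prems(2) sa[of u x] fu by auto
    qed
    moreover have "dim ?S' < dim S"
    proof (rule dim_psubset)
      have "u \<notin> ?S'" using uu by simp
      then have "?S' \<subset> S" using uS by blast
      then show "span ?S' \<subset> span S"
        using sub less.prems(1) by (simp only: span_eq_iff[THEN iffD2])
    qed
    ultimately obtain B where B: "B \<subseteq> ?S'" "pairwise orthogonal B"
        "\<forall>v\<in>B. norm v = 1 \<and> (\<exists>c. f v = c *\<^sub>R v)" "span B = ?S'"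
      using less.hyps[of ?S'] by blast
    have "span (insert u B) = S"
    proof
      show "span (insert u B) \<subseteq> S"
        using B(1) uS less.prems(1) by (intro span_minimal) auto
      show "S \<subseteq> span (insert u B)"
      proof
        fix x assume "x \<in> S"
        then have "x - (u \<bullet> x) *\<^sub>R u \<in> span B"
          using uS less.prems(1) by (auto simp: B(4) subspace_diff subspace_scale inner_diff_right uu)
        then show "x \<in> span (insert u B)"
          by (auto simp: span_insert)
      qed
    qed
    moreover have "pairwise orthogonal (insert u B)"
      using B(1,2) by (auto simp: pairwise_insert orthogonal_def inner_commute)
    ultimately show ?thesis
      using B uS nu fu by (intro exI[of _ "insert u B"]) auto
  qed
qed

section \<open>Symmetric matrices and diagonalisation in an orthonormal basis\<close>

lemma inner_symmetric_matrix:
  fixes A :: "real^'n^'n::finite"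
  assumes "transpose A = A"
  shows "(A *v x) \<bullet> y = x \<bullet> (A *v y)"
  using assms dot_lmul_matrix[of x A y] transpose_matrix_vector[of A x] by simp

lemma symmetric_matrixI:
  fixes A :: "real^'n^'n::finite"
  assumes "\<And>x y. (A *v x) \<bullet> y = x \<bullet> (A *v y)"
  shows "transpose A = A"
proof -
  have "(transpose A *v x) \<bullet> y = (A *v x) \<bullet> y" for x y
    by (simp add: assms dot_lmul_matrix)
  then show ?thesis
    by (metis matrix_eq vector_eq_rdot)
qed

text \<open>For orthonormal \<open>B\<close> spanning the space, this is the matrix with
  eigenvectors \<open>B\<close> and eigenvalues \<open>g\<close>. With \<open>B\<close> fixed,
  matrix products become pointwise products of eigenvalue functions.\<close>

definition spectral_matrix :: "(real^'n) set \<Rightarrow> (real^'n \<Rightarrow> real) \<Rightarrow> real^'n^'n::finite" where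
  "spectral_matrix B g = matrix (\<lambda>x. \<Sum>v\<in>B. (g v * (v \<bullet> x)) *\<^sub>R v)"

definition orthonormal_basis :: "'a::euclidean_space set \<Rightarrow> bool" where
  "orthonormal_basis B \<longleftrightarrow> pairwise orthogonal B \<and> (\<forall>v\<in>B. norm v = 1) \<and> span B = UNIV"

lemma finite_orthonormal_basis: "orthonormal_basis B \<Longrightarrow> finite B"
  unfolding orthonormal_basis_def
  by (metis finiteI_independent norm_zero pairwise_orthogonal_independent zero_neq_one)

lemma inner_orthonormal_basis:
  "orthonormal_basis B \<Longrightarrow> u \<in> B \<Longrightarrow> v \<in> B \<Longrightarrow> u \<bullet> v = (if u = v then 1 else 0)"
  by (auto simp: orthonormal_basis_def pairwise_def orthogonal_def dot_square_norm)

lemma spectral_matrix_mult_vec: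
  "spectral_matrix B g *v x = (\<Sum>v\<in>B. (g v * (v \<bullet> x)) *\<^sub>R v)"
proof -
  have "linear (\<lambda>x. \<Sum>v\<in>B. (g v * (v \<bullet> x)) *\<^sub>R v)"
    by (intro linear_compose_sum ballI linearI) (auto simp: inner_add_right algebra_simps)
  then show ?thesis
    unfolding spectral_matrix_def by (simp add: matrix_works)
qed

lemma spectral_matrix_basis_vec:
  assumes "orthonormal_basis B" "v \<in> B"
  shows "spectral_matrix B g *v v = g v *\<^sub>R v"
proof -
  have "(\<Sum>u\<in>B. (g u * (u \<bullet> v)) *\<^sub>R u) = (\<Sum>u\<in>B. if u = v then g v *\<^sub>R v else 0)"
    using assms by (intro sum.cong) (auto simp: inner_orthonormal_basis)
  then show ?thesis
    using assms(2) finite_orthonormal_basis[OF assms(1)] by (simp add: spectral_matrix_mult_vec)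
qed

lemma matrix_eq_on_basis:
  fixes A C :: "real^'n^'n::finite"
  assumes "orthonormal_basis B" "\<And>v. v \<in> B \<Longrightarrow> A *v v = C *v v"
  shows "A = C"
proof -
  have "A *v x = C *v x" for x
    using assms linear_eq_on[OF matrix_vector_mul_linear matrix_vector_mul_linear, of x B A C]
    by (auto simp: orthonormal_basis_def)
  then show ?thesis by (simp add: matrix_eq)
qed

lemma spectral_matrix_mult:
  assumes "orthonormal_basis B"
  shows "spectral_matrix B g ** spectral_matrix B h = spectral_matrix B (\<lambda>v. g v * h v)"
  using assms
  by (intro matrix_eq_on_basis[OF assms])
    (simp add: spectral_matrix_basis_vec matrix_vector_mult_scaleR
      flip: matrix_vector_mul_assoc)

lemma transpose_spectral_matrix [simp]:
  "transpose (spectral_matrix B g) = spectral_matrix B g"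
  by (intro symmetric_matrixI)
    (simp add: spectral_matrix_mult_vec inner_sum_left inner_sum_right inner_commute ac_simps)

lemma pos_semidef_spectral_matrix:
  assumes "\<And>v. v \<in> B \<Longrightarrow> 0 \<le> g v"
  shows "pos_semidef (spectral_matrix B g)"
  using assms unfolding pos_semidef_def
  by (auto simp: spectral_matrix_mult_vec inner_sum_right inner_commute mult.assoc intro!: sum_nonneg)

lemma pos_semidef_spectral:
  fixes A :: "real^'n^'n::finite"
  assumes "pos_semidef A"
  obtains B g where "orthonormal_basis B" "\<And>v. v \<in> B \<Longrightarrow> 0 \<le> g v"
    "A = spectral_matrix B g"
proof -
  have sym: "transpose A = A" and nonneg: "\<And>x. 0 \<le> x \<bullet> (A *v x)"
    using assms by (auto simp: pos_semidef_def)
  obtain B where B: "orthonormal_basis B" "\<forall>v\<in>B. \<exists>c. A *v v = c *\<^sub>R v"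
    using selfadjoint_orthonormal_eigenbasis[OF matrix_vector_mul_linear
        inner_symmetric_matrix[OF sym] subspace_UNIV]
    unfolding orthonormal_basis_def by blast
  \<comment> \<open>Reading the eigenvalue off as a Rayleigh quotient makes its nonnegativity
    immediate.\<close>
  define g where "g v = v \<bullet> (A *v v)" for v
  have "A *v v = g v *\<^sub>R v" if v: "v \<in> B" for v
  proof -
    obtain c where "A *v v = c *\<^sub>R v" using B v by blast
    moreover have "v \<bullet> v = 1" using B v by (simp add: inner_orthonormal_basis)
    ultimately show ?thesis by (simp add: g_def)
  qed
  then have "A = spectral_matrix B g"
    by (intro matrix_eq_on_basis[OF B(1)]) (simp add: spectral_matrix_basis_vec[OF B(1)])
  then show ?thesis
    using that[of B g] B(1) nonneg by (simp add: g_def)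
qed

subsection \<open>Pseudoinverse and square root\<close>

definition penrose :: "real^'n^'n \<Rightarrow> real^'n^'n::finite \<Rightarrow> bool" where
  "penrose A X \<longleftrightarrow> A ** X ** A = A \<and> X ** A ** X = X \<and>
     transpose (A ** X) = A ** X \<and> transpose (X ** A) = X ** A"

text \<open>\<open>A ** X\<close> and \<open>A ** Y\<close> are orthogonal projections onto the
  range of \<open>A\<close>, hence equal; likewise \<open>X ** A = Y ** A\<close>. Then X = XAX =
  XAY = YAY = Y.\<close>

lemma penrose_unique:
  assumes "penrose A X" "penrose A Y"
  shows "X = Y"
proof -
  have X: "A ** X ** A = A" "X ** A ** X = X" "transpose (A ** X) = A ** X" "transpose (X ** A) = X ** A"
    and Y: "A ** Y ** A = A" "Y ** A ** Y = Y" "transpose (A ** Y) = A ** Y" "transpose (Y ** A) = Y ** A"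
    using assms by (auto simp: penrose_def)
  have "A ** X = (A ** Y) ** (A ** X)"
    using Y(1) by (simp add: matrix_mul_assoc)
  also have "\<dots> = transpose ((A ** X) ** (A ** Y))"
    using X(3) Y(3) by (simp add: matrix_transpose_mul)
  also have "(A ** X) ** (A ** Y) = A ** Y"
    using X(1) by (simp add: matrix_mul_assoc)
  finally have AX: "A ** X = A ** Y" using Y(3) by simp
  have "X ** A = (X ** A) ** (Y ** A)"
    using Y(1) by (simp flip: matrix_mul_assoc)
  also have "\<dots> = transpose ((Y ** A) ** (X ** A))"
    using X(4) Y(4) by (simp add: matrix_transpose_mul)
  also have "(Y ** A) ** (X ** A) = Y ** A"
    using X(1) by (simp flip: matrix_mul_assoc)
  finally have XA: "X ** A = Y ** A" using Y(4) by simp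
  have "X = X ** (A ** X)" using X(2) by (simp add: matrix_mul_assoc)
  also have "\<dots> = X ** A ** Y" by (simp add: AX matrix_mul_assoc)
  also have "\<dots> = Y" by (simp add: XA Y(2))
  finally show ?thesis .
qed

lemma pinv_pos_semidef:
  assumes "pos_semidef A"
  shows "penrose A (pinv A)" and "pos_semidef (pinv A)"
proof -
  obtain B g where B: "orthonormal_basis B" "\<And>v. v \<in> B \<Longrightarrow> 0 \<le> g v"
    and A: "A = spectral_matrix B g"
    using pos_semidef_spectral[OF assms] by metis
  \<comment> \<open>The convention \<open>inverse 0 = 0\<close> sends the kernel of \<open>A\<close>
    to zero, as the Penrose equations demand.\<close>
  let ?X = "spectral_matrix B (\<lambda>v. inverse (g v))"
  have "(\<lambda>v. g v * inverse (g v) * g v) = g"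
    "(\<lambda>v. inverse (g v) * g v * inverse (g v)) = (\<lambda>v. inverse (g v))"
    by (simp_all add: fun_eq_iff field_simps)
  then have X: "penrose A ?X"
    unfolding penrose_def A by (simp add: spectral_matrix_mult[OF B(1)])
  have "pinv A = ?X"
    unfolding pinv_def penrose_def[symmetric] using X penrose_unique by (intro the_equality)
  with X show "penrose A (pinv A)" "pos_semidef (pinv A)"
    using B(2) by (auto intro: pos_semidef_spectral_matrix)
qed

text \<open>Let \<open>v\<close> be an eigenvector of \<open>R\<close> with eigenvalue r. Since S^2
  = R^2, (S + r)(S - r)v = 0. If r > 0, a nonzero (S - r)v would be an eigenvector of
  \<open>S\<close> with eigenvalue -r, against semidefiniteness; if r = 0, then |Sv|^2 = v . S^2 v =
  0.\<close>

lemma pos_semidef_sqrt_unique: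
  assumes R: "pos_semidef R" "R ** R = A" and S: "pos_semidef S" "S ** S = A"
  shows "S = R"
proof -
  obtain B r where B: "orthonormal_basis B" "\<And>v. v \<in> B \<Longrightarrow> 0 \<le> r v"
    and Rr: "R = spectral_matrix B r"
    using pos_semidef_spectral[OF R(1)] by metis
  have symS: "(S *v x) \<bullet> y = x \<bullet> (S *v y)" and nonneg: "0 \<le> x \<bullet> (S *v x)" for x y
    using S(1) inner_symmetric_matrix by (auto simp: pos_semidef_def)
  have "S *v v = r v *\<^sub>R v" if v: "v \<in> B" for v
  proof -
    have Rv: "R *v v = r v *\<^sub>R v"
      using B(1) v by (simp add: Rr spectral_matrix_basis_vec)
    have "S *v (S *v v) = R *v (R *v v)"
      using R(2) S(2) by (simp add: matrix_vector_mul_assoc)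
    then have SS: "S *v (S *v v) = (r v * r v) *\<^sub>R v"
      by (simp add: Rv matrix_vector_mult_scaleR)
    show ?thesis
    proof (cases "r v = 0")
      case True
      have "(S *v v) \<bullet> (S *v v) = v \<bullet> (S *v (S *v v))" by (rule symS)
      then show ?thesis using SS True by simp
    next
      case False
      define y where "y = S *v v - r v *\<^sub>R v"
      have "S *v y = - r v *\<^sub>R y"
        by (simp add: y_def matrix_vector_mult_diff_distrib SS matrix_vector_mult_scaleR
            scaleR_diff_right)
      then have "0 \<le> - (r v * (y \<bullet> y))" using nonneg[of y] by simp
      moreover have "r v > 0" using False B(2)[OF v] by simp
      ultimately have "y \<bullet> y \<le> 0"
        by (simp add: mult_le_0_iff)
      then have "y = 0" by (metis inner_eq_zero_iff inner_ge_zero order_antisym)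
      then show ?thesis by (simp add: y_def)
    qed
  qed
  then show ?thesis
    using B(1) by (intro matrix_eq_on_basis[OF B(1)]) (simp add: Rr spectral_matrix_basis_vec)
qed

lemma psd_sqrt_pos_semidef:
  assumes "pos_semidef A"
  shows "pos_semidef (psd_sqrt A)" and "psd_sqrt A ** psd_sqrt A = A"
proof -
  obtain B g where B: "orthonormal_basis B" "\<And>v. v \<in> B \<Longrightarrow> 0 \<le> g v"
    and A: "A = spectral_matrix B g"
    using pos_semidef_spectral[OF assms] by metis
  \<comment> \<open>The absolute value makes the root nonnegative without a side condition; on
    \<open>B\<close> it equals \<open>g v\<close>.\<close>
  let ?S = "spectral_matrix B (\<lambda>v. sqrt \<bar>g v\<bar>)"
  have "?S ** ?S = A"
    using B by (intro matrix_eq_on_basis[OF B(1)])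
      (simp add: A spectral_matrix_mult spectral_matrix_basis_vec)
  moreover have "pos_semidef ?S"
    by (rule pos_semidef_spectral_matrix) simp
  ultimately have S: "pos_semidef ?S \<and> ?S ** ?S = A" by simp
  then have "psd_sqrt A = ?S"
    unfolding psd_sqrt_def using pos_semidef_sqrt_unique by (intro the_equality) blast+
  with S show "pos_semidef (psd_sqrt A)" "psd_sqrt A ** psd_sqrt A = A" by auto
qed

subsection \<open>Local risk and leverage scores\<close>

lemma edge_mat_mult_vec: "edge_mat ori e *v x = (edge_vec ori e \<bullet> x) *\<^sub>R edge_vec ori e"
  unfolding edge_mat_def
  by (simp add: vec_eq_iff matrix_vector_mult_def matrix_matrix_mult_def columnvector_def
      rowvector_def inner_vec_def sum_distrib_right sum_distrib_left ac_simps)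

text \<open>Cauchy-Schwarz gives the upper bound, and the vector \<open>y\<close> attains
  it.\<close>

lemma onorm_rank_one:
  fixes y :: "'a::euclidean_space"
  assumes "c \<ge> 0"
  shows "onorm (\<lambda>x. (c * (y \<bullet> x)) *\<^sub>R y) = c * (y \<bullet> y)"
proof (cases "y = 0")
  case True
  then show ?thesis by (simp add: onorm_zero)
next
  case False
  let ?f = "\<lambda>x. (c * (y \<bullet> x)) *\<^sub>R y"
  have bnd: "norm (?f x) \<le> (c * (y \<bullet> y)) * norm x" for x
  proof -
    have "c * \<bar>y \<bullet> x\<bar> * norm y \<le> c * (norm y * norm x) * norm y"
      using assms Cauchy_Schwarz_ineq2[of y x] by (intro mult_right_mono mult_left_mono) auto
    then show ?thesis
      using assms by (simp add: abs_mult dot_square_norm power2_eq_square ac_simps)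
  qed
  have "bounded_linear ?f"
    by (intro bounded_linear_intros)
  then have "norm (?f y) / norm y \<le> onorm ?f" by (rule le_onorm)
  moreover have "norm (?f y) / norm y = c * (y \<bullet> y)"
    using False assms by (simp add: abs_mult)
  ultimately show ?thesis using onorm_le[of ?f, OF bnd] by linarith
qed

text \<open>Conjugation by a symmetric \<open>R\<close> keeps the matrix rank one and replaces the
  edge vector by its image under \<open>R\<close>.\<close>

lemma spectral_norm_sandwich_edge_mat:
  assumes R: "transpose R = R" and c: "c \<ge> 0"
  shows "spectral_norm (R ** (c *\<^sub>R edge_mat ori e) ** R)
    = c * (edge_vec ori e \<bullet> ((R ** R) *v edge_vec ori e))"
proof -
  let ?y = "R *v edge_vec ori e"
  have "(R ** (c *\<^sub>R edge_mat ori e) ** R) *v x = (c * (?y \<bullet> x)) *\<^sub>R ?y" for x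
    by (simp flip: matrix_vector_mul_assoc scaleR_matrix_vector_assoc
        add: edge_mat_mult_vec matrix_vector_mult_scaleR inner_symmetric_matrix[OF R])
  then have "spectral_norm (R ** (c *\<^sub>R edge_mat ori e) ** R) = c * (?y \<bullet> ?y)"
    unfolding spectral_norm_def using onorm_rank_one[OF c, of ?y] by presburger
  then show ?thesis
    by (simp add: inner_symmetric_matrix[OF R] flip: matrix_vector_mul_assoc)
qed

lemma laplacian_mult_vec:
  "laplacian E w ori *v x = (\<Sum>e\<in>E. (w e * (edge_vec ori e \<bullet> x)) *\<^sub>R edge_vec ori e)"
proof (induction E rule: infinite_finite_induct)
  case (insert e E)
  then show ?case
    by (simp add: laplacian_def matrix_vector_mult_add_rdistrib edge_mat_mult_vec
        flip: scaleR_matrix_vector_assoc)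
qed (simp_all add: laplacian_def)

lemma pos_semidef_laplacian:
  assumes "\<And>e. e \<in> E \<Longrightarrow> 0 \<le> w e"
  shows "pos_semidef (laplacian E w ori)"
  unfolding pos_semidef_def
proof (intro conjI symmetric_matrixI allI)
  show "(laplacian E w ori *v x) \<bullet> y = x \<bullet> (laplacian E w ori *v y)" for x y
    by (simp add: laplacian_mult_vec inner_sum_left inner_sum_right inner_commute ac_simps)
  show "0 \<le> x \<bullet> (laplacian E w ori *v x)" for x
    using assms
    by (auto simp: laplacian_mult_vec inner_sum_right inner_commute mult.assoc intro!: sum_nonneg)
qed

text \<open>At a zero marginal both quotients are 0 by the convention \<open>x / 0 = 0\<close>, so
  the formula covers every \<open>D\<close>.\<close>

lemma local_risk_eq_Max:
  assumes "\<And>e. e \<in> E \<Longrightarrow> 0 \<le> w e"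
  shows "local_risk E w ori D = Max ((\<lambda>e. leverage E w ori e / marginal D e) ` E)"
proof -
  have P: "pos_semidef (pinv (laplacian E w ori))"
    by (intro pinv_pos_semidef pos_semidef_laplacian assms)
  have "spectral_norm (psd_sqrt (pinv (laplacian E w ori)) **
      ((w e / marginal D e) *\<^sub>R edge_mat ori e) ** psd_sqrt (pinv (laplacian E w ori)))
    = leverage E w ori e / marginal D e" if "e \<in> E" for e
  proof -
    have "0 \<le> w e / marginal D e"
      using assms[OF that] by (simp add: marginal_def)
    then show ?thesis
      using psd_sqrt_pos_semidef[OF P]
      by (subst spectral_norm_sandwich_edge_mat) (auto simp: pos_semidef_def leverage_def)
  qed
  then show ?thesis
    unfolding local_risk_def Let_def by (intro arg_cong[of _ _ Max] image_cong) auto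
qed

text \<open>With b = Kq/Z and K K^+ K = K, the form b . K^+ b collapses to q . Kq / Z^2 = q . b / Z.
  Any solution \<open>q\<close> thus replaces the pseudoinverse.\<close>

lemma leverage_eq_potential:
  assumes w: "\<And>e. e \<in> E \<Longrightarrow> 0 \<le> w e"
    and q: "laplacian E w ori *v q = Z *\<^sub>R edge_vec ori e" and Z: "Z \<noteq> 0"
  shows "leverage E w ori e = w e * (q \<bullet> edge_vec ori e) / Z"
proof -
  let ?K = "laplacian E w ori"
  let ?b = "edge_vec ori e"
  have psd: "pos_semidef ?K" using w by (rule pos_semidef_laplacian)
  have b: "?b = (1 / Z) *\<^sub>R (?K *v q)" using q Z by simp
  have "(?K *v q) \<bullet> (pinv ?K *v (?K *v q)) = q \<bullet> ((?K ** pinv ?K ** ?K) *v q)"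
    using psd by (simp add: inner_symmetric_matrix pos_semidef_def flip: matrix_vector_mul_assoc)
  also have "\<dots> = Z * (q \<bullet> ?b)"
    using pinv_pos_semidef(1)[OF psd] by (simp add: penrose_def q)
  finally have "Z * Z * (?b \<bullet> (pinv ?K *v ?b)) = Z * (q \<bullet> ?b)"
    by (simp add: q matrix_vector_mult_scaleR)
  then show ?thesis
    using Z by (simp add: leverage_def field_simps)
qed

subsection \<open>Spanning trees as bases\<close>

definition reach :: "'n set set \<Rightarrow> ('n \<times> 'n) set" where
  "reach F = {(x, y). {x, y} \<in> F}\<^sup>*"

lemma reach_sym: "(x, y) \<in> reach F \<Longrightarrow> (y, x) \<in> reach F"
  unfolding reach_def
  by (rule symD[OF sym_rtrancl]) (auto simp: sym_def insert_commute)

lemma reach_trans: "(x, y) \<in> reach F \<Longrightarrow> (y, z) \<in> reach F \<Longrightarrow> (x, z) \<in> reach F"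
  unfolding reach_def by (rule rtrancl_trans)

lemma reach_edge: "{x, y} \<in> F \<Longrightarrow> (x, y) \<in> reach F"
  unfolding reach_def by (rule r_into_rtrancl) simp

text \<open>Loops are removed as the walk grows: if the new endpoint already lies on the path, the
  path is cut back to that occurrence.\<close>

lemma rtrancl_distinct_path:
  assumes "(x, y) \<in> r\<^sup>*"
  shows "\<exists>xs. xs \<noteq> [] \<and> hd xs = x \<and> last xs = y \<and> distinct xs \<and>
    (\<forall>i. Suc i < length xs \<longrightarrow> (xs ! i, xs ! Suc i) \<in> r)"
  using assms
proof (induction rule: rtrancl_induct)
  case base
  show ?case by (intro exI[of _ "[x]"]) simp
next
  case (step y z)
  then obtain xs where xs: "xs \<noteq> []" "hd xs = x" "last xs = y" "distinct xs"
    "\<And>i. Suc i < length xs \<Longrightarrow> (xs ! i, xs ! Suc i) \<in> r" by blast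
  show ?case
  proof (cases "z \<in> set xs")
    case True
    then obtain ys zs where "xs = ys @ z # zs" by (auto dest: split_list)
    then have split: "xs = (ys @ [z]) @ zs" by simp
    have "((ys @ [z]) ! i, (ys @ [z]) ! Suc i) \<in> r" if "Suc i < length (ys @ [z])" for i
    proof -
      have "xs ! i = (ys @ [z]) ! i" "xs ! Suc i = (ys @ [z]) ! Suc i"
        using that split by (metis Suc_lessD nth_append)+
      then show ?thesis using xs(5)[of i] that by (simp add: split)
    qed
    then show ?thesis
      using xs(2,4) by (intro exI[of _ "ys @ [z]"]) (auto simp: split hd_append)
  next
    case False
    have "((xs @ [z]) ! i, (xs @ [z]) ! Suc i) \<in> r" if "Suc i < length (xs @ [z])" for i
    proof (cases "Suc i < length xs")
      case True
      then show ?thesis using xs(5)[of i] by (simp add: nth_append)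
    next
      case F: False
      then have i: "Suc i = length xs" using that by simp
      then have "xs ! i = y" using xs(1,3) by (simp add: last_conv_nth flip: i)
      then show ?thesis using step(2) i by (simp add: nth_append)
    qed
    then show ?thesis
      using xs False by (intro exI[of _ "xs @ [z]"]) auto
  qed
qed

text \<open>A simple path from \<open>u\<close> to \<open>v\<close> avoiding the edge is itself the
  cycle: the edge is the wrap-around step of \<open>is_cycle\<close>.\<close>

lemma is_cycle_if_reach_Diff:
  assumes uv: "{u, v} \<in> F" "u \<noteq> v" and r: "(u, v) \<in> reach (F - {{u, v}})"
  shows "\<exists>xs. is_cycle F xs"
proof -
  obtain xs where xs: "xs \<noteq> []" "hd xs = u" "last xs = v" "distinct xs"
    and step: "\<And>i. Suc i < length xs \<Longrightarrow> {xs ! i, xs ! Suc i} \<in> F - {{u, v}}"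
    using rtrancl_distinct_path[OF r[unfolded reach_def]] by auto
  define k where "k = length xs"
  have u: "xs ! 0 = u" and v: "xs ! (k - 1) = v"
    using xs by (simp_all add: hd_conv_nth last_conv_nth k_def)
  \<comment> \<open>A single vertex would force \<open>u = v\<close>; with two vertices the only
    step would be the removed edge.\<close>
  have k: "k \<ge> 3"
  proof -
    have "k \<noteq> 0" using xs(1) by (simp add: k_def)
    moreover have "k \<noteq> 1" using u v uv(2) by auto
    moreover have "k \<noteq> 2" using u v step[of 0] by (auto simp: k_def)
    ultimately show ?thesis by linarith
  qed
  have "{xs ! i, xs ! (Suc i mod k)} \<in> F" if "i < k" for i
  proof (cases "Suc i = k")
    case True
    then have "i = k - 1" by simp
    then show ?thesis using u v uv(1) True by (simp add: insert_commute)
  next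
    case False
    then show ?thesis using that step[of i] by (simp add: k_def)
  qed
  then have "is_cycle F xs"
    using k xs(4) by (simp add: is_cycle_def k_def)
  then show ?thesis ..
qed

text \<open>The edge removed is the wrap-around one; the other steps of the cycle still join its
  ends.\<close>

lemma reach_Diff_if_is_cycle:
  assumes "is_cycle F xs"
  shows "\<exists>u v. {u, v} \<in> F \<and> (u, v) \<in> reach (F - {{u, v}})"
proof -
  define k where "k = length xs"
  have k: "k \<ge> 3" and d: "distinct xs"
    and step: "\<And>i. i < k \<Longrightarrow> {xs ! i, xs ! (Suc i mod k)} \<in> F"
    using assms by (auto simp: is_cycle_def k_def)
  let ?g = "{xs ! 0, xs ! (k - 1)}"
  have "?g \<in> F" using step[of "k - 1"] k by (simp add: insert_commute)
  moreover have "(xs ! 0, xs ! i) \<in> reach (F - {?g})" if "i < k" for i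
    using that
  proof (induction i)
    case 0
    show ?case by (simp add: reach_def)
  next
    case (Suc i)
    have "{xs ! i, xs ! Suc i} \<in> F" using step[of i] Suc.prems by simp
    moreover have "xs ! i = xs ! j \<longleftrightarrow> i = j" if "i < k" "j < k" for i j
      using nth_eq_iff_index_eq[OF d] that by (simp add: k_def)
    \<comment> \<open>This needs \<open>k \<ge> 3\<close>: for two vertices the step from 0 to 1
      would be the wrap-around edge.\<close>
    then have "{xs ! i, xs ! Suc i} \<noteq> ?g"
      using Suc.prems k by (auto simp: doubleton_eq_iff)
    ultimately have "{xs ! i, xs ! Suc i} \<in> F - {?g}" by simp
    then show ?case
      using Suc unfolding reach_def by (auto intro: rtrancl_into_rtrancl)
  qed
  ultimately show ?thesis using k by (intro exI[of _ "xs ! 0"] exI[of _ "xs ! (k - 1)"]) auto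
qed

lemma marginal_eq_sum:
  fixes D :: "'n::finite set set pmf"
  shows "marginal D e = (\<Sum>T\<in>{T. e \<in> T}. pmf D T)"
  by (simp add: marginal_def measure_measure_pmf_finite)

section \<open>Edge vectors, cuts and linear independence\<close>

definition indicator_vec :: "'n set \<Rightarrow> real^'n::finite" where
  "indicator_vec C = (\<chi> i. of_bool (i \<in> C))"

lemma inner_indicator_vec_axis [simp]: "indicator_vec C \<bullet> axis v 1 = of_bool (v \<in> C)"
  by (simp add: indicator_vec_def inner_axis)

lemma inner_indicator_vec_edge_vec:
  "indicator_vec C \<bullet> edge_vec ori e = of_bool (fst (ori e) \<in> C) - of_bool (snd (ori e) \<in> C)"
  by (simp add: edge_vec_def inner_diff_right)

lemma inner_eq_0_span:
  assumes "\<And>y. y \<in> S \<Longrightarrow> p \<bullet> y = 0" "x \<in> span S"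
  shows "p \<bullet> x = 0"
  using span_minimal[OF _ subspace_hyperplane, of S p] assms by blast

lemma span_eq_if_spanning_subset:
  assumes "S \<subseteq> T" "T \<subseteq> span S"
  shows "span S = span T"
proof
  show "span S \<subseteq> span T" using assms(1) by (rule span_mono)
  show "span T \<subseteq> span S" using assms(2) subspace_span by (rule span_minimal)
qed

locale oriented_graph =
  fixes E :: "'n::finite set set" and ori :: "'n set \<Rightarrow> 'n \<times> 'n"
  assumes simple: "simple_graph E" and ori: "orientation E ori"
begin

abbreviation b :: "'n set \<Rightarrow> real^'n" where "b \<equiv> edge_vec ori"

lemma edge_eq: "e \<in> E \<Longrightarrow> {fst (ori e), snd (ori e)} = e"
  using ori unfolding orientation_def by metis

lemma ends_distinct:
  assumes "e \<in> E"
  shows "fst (ori e) \<noteq> snd (ori e)"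
proof
  assume "fst (ori e) = snd (ori e)"
  then have "e = {snd (ori e)}" using edge_eq[OF assms] by simp
  then have "card e = 1" by (metis is_singletonI is_singleton_altdef)
  then show False using simple assms by (simp add: simple_graph_def)
qed

text \<open>The support of an edge vector is the edge itself. Injectivity transfers cardinalities
  and set differences between edges and their vectors.\<close>

lemma edge_vec_inj: "inj_on b E"
proof (rule inj_onI)
  fix e f assume ef: "e \<in> E" "f \<in> E" "b e = b f"
  have supp: "{i. b e $ i \<noteq> 0} = e" if "e \<in> E" for e
  proof -
    have "b e $ i \<noteq> 0 \<longleftrightarrow> i = fst (ori e) \<or> i = snd (ori e)" for i
      using ends_distinct[OF that] by (simp add: edge_vec_def axis_def)
    then have "{i. b e $ i \<noteq> 0} = {fst (ori e), snd (ori e)}" by blast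
    then show ?thesis by (simp only: edge_eq[OF that])
  qed
  show "e = f" using supp[OF ef(1)] unfolding ef(3) supp[OF ef(2)] by (rule sym)
qed

lemma edge_vec_nonzero: "e \<in> E \<Longrightarrow> b e \<noteq> 0"
  using ends_distinct[of e] by (simp add: edge_vec_def axis_eq_axis)

lemma axis_diff_edge:
  assumes "F \<subseteq> E" "{x, y} \<in> F"
  shows "axis x 1 - axis y 1 \<in> span (b ` F)"
proof -
  have "{fst (ori {x, y}), snd (ori {x, y})} = {x, y}"
    by (rule edge_eq[OF subsetD[OF assms]])
  then consider "fst (ori {x, y}) = x" "snd (ori {x, y}) = y"
    | "fst (ori {x, y}) = y" "snd (ori {x, y}) = x"
    unfolding doubleton_eq_iff by argo
  then have "axis x 1 - axis y 1 = b {x, y} \<or> axis x 1 - axis y 1 = - b {x, y}"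
    by cases (simp_all add: edge_vec_def)
  moreover have "b {x, y} \<in> span (b ` F)"
    using assms(2) by (intro span_base imageI)
  ultimately show ?thesis by (elim disjE) (simp_all only: span_neg)
qed

text \<open>If \<open>F\<close> is a spanning tree with \<open>g\<close> removed, this indicates the
  side of the resulting cut that holds the tail of \<open>g\<close>; taking the tail makes the
  pairing with \<open>b g\<close> equal to +1.\<close>

definition potential :: "'n set set \<Rightarrow> 'n set \<Rightarrow> real^'n" where
  "potential F g = indicator_vec (reach F `` {fst (ori g)})"

lemma indicator_reach_edge:
  assumes "F \<subseteq> E" "h \<in> F"
  shows "indicator_vec (reach F `` {x}) \<bullet> b h = 0"
proof -
  have "{fst (ori h), snd (ori h)} \<in> F"
    using assms(2) unfolding edge_eq[OF subsetD[OF assms]] .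
  then have h: "(fst (ori h), snd (ori h)) \<in> reach F" by (rule reach_edge)
  have "(x, fst (ori h)) \<in> reach F \<longleftrightarrow> (x, snd (ori h)) \<in> reach F"
    using reach_trans[OF _ h] reach_trans[OF _ reach_sym[OF h]] by (rule iffI)
  then show ?thesis by (simp add: inner_indicator_vec_edge_vec)
qed

text \<open>The indicator of the component of \<open>x\<close> annihilates every edge vector of
  \<open>F\<close>, so a difference in their span cannot leave the component. Conversely, edge
  vectors telescope along a walk.\<close>

lemma axis_diff_in_span_iff:
  assumes F: "F \<subseteq> E"
  shows "axis x 1 - axis y 1 \<in> span (b ` F) \<longleftrightarrow> (x, y) \<in> reach F"
proof
  assume sp: "axis x 1 - axis y 1 \<in> span (b ` F)"
  have "indicator_vec (reach F `` {x}) \<bullet> (axis x 1 - axis y 1) = 0"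
    using indicator_reach_edge[OF F] by (intro inner_eq_0_span[OF _ sp]) auto
  then have "(y \<in> reach F `` {x}) = (x \<in> reach F `` {x})"
    unfolding inner_diff_right inner_indicator_vec_axis by (simp add: of_bool_def split: if_splits)
  then show "(x, y) \<in> reach F" by (simp add: reach_def)
next
  assume "(x, y) \<in> reach F"
  then show "axis x 1 - axis y 1 \<in> span (b ` F)"
    unfolding reach_def
  proof (induction rule: rtrancl_induct)
    case base
    show ?case by (simp add: span_zero)
  next
    case (step y z)
    then have "axis y 1 - axis z 1 \<in> span (b ` F)" by (auto intro: axis_diff_edge[OF F])
    from span_add[OF step.IH this] show ?case by simp
  qed
qed

lemma independent_edge_vecs_iff:
  assumes F: "F \<subseteq> E"
  shows "independent (b ` F) \<longleftrightarrow> (\<forall>g\<in>F. (fst (ori g), snd (ori g)) \<notin> reach (F - {g}))"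
proof -
  have "b ` F - {b g} = b ` (F - {g})" if "g \<in> F" for g
    using inj_on_image_set_diff[OF edge_vec_inj, of F "{g}"] F that by auto
  then have "independent (b ` F) \<longleftrightarrow> (\<forall>g\<in>F. b g \<notin> span (b ` (F - {g})))"
    unfolding dependent_def by simp
  also have "\<dots> \<longleftrightarrow> (\<forall>g\<in>F. (fst (ori g), snd (ori g)) \<notin> reach (F - {g}))"
  proof -
    have "F - {g} \<subseteq> E" for g using F by blast
    then have "b g \<in> span (b ` (F - {g})) \<longleftrightarrow> (fst (ori g), snd (ori g)) \<in> reach (F - {g})" for g
      unfolding edge_vec_def[of ori g] by (rule axis_diff_in_span_iff)
    then show ?thesis by (simp only:)
  qed
  finally show ?thesis .
qed

text \<open>A cycle and a linear dependence both amount to an edge whose ends stay connected after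
  its removal.\<close>

lemma acyclic_iff_independent:
  assumes F: "F \<subseteq> E"
  shows "(\<nexists>xs. is_cycle F xs) \<longleftrightarrow> independent (b ` F)"
proof -
  have "(\<exists>xs. is_cycle F xs) \<longleftrightarrow> (\<exists>g\<in>F. (fst (ori g), snd (ori g)) \<in> reach (F - {g}))"
  proof
    assume "\<exists>xs. is_cycle F xs"
    then obtain u v where uv: "{u, v} \<in> F" "(u, v) \<in> reach (F - {{u, v}})"
      using reach_Diff_if_is_cycle by metis
    have "{fst (ori {u, v}), snd (ori {u, v})} = {u, v}"
      by (rule edge_eq[OF subsetD[OF F uv(1)]])
    then have "(fst (ori {u, v}), snd (ori {u, v})) \<in> reach (F - {{u, v}})"
      using uv(2) reach_sym[OF uv(2)] unfolding doubleton_eq_iff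
      by (elim disjE conjE) (simp_all only:)
    then show "\<exists>g\<in>F. (fst (ori g), snd (ori g)) \<in> reach (F - {g})"
      using uv(1) by blast
  next
    assume "\<exists>g\<in>F. (fst (ori g), snd (ori g)) \<in> reach (F - {g})"
    then obtain g where g: "g \<in> F" "(fst (ori g), snd (ori g)) \<in> reach (F - {g})" by blast
    then have "g \<in> E" using F by blast
    then show "\<exists>xs. is_cycle F xs"
      using is_cycle_if_reach_Diff[of "fst (ori g)" "snd (ori g)" F] ends_distinct[of g] g
      by (simp add: edge_eq)
  qed
  then show ?thesis by (simp add: independent_edge_vecs_iff[OF F])
qed

end

section \<open>Spanning trees of a connected weighted graph\<close>

locale weighted_graph = oriented_graph E ori
  for E :: "'n::finite set set" and ori :: "'n set \<Rightarrow> 'n \<times> 'n" +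
  fixes w :: "'n set \<Rightarrow> real"
  assumes connected: "connected_graph E" and weight_pos: "\<And>e. e \<in> E \<Longrightarrow> w e > 0"
begin

text \<open>Acyclic means independent, and connected means spanning because \<open>E\<close> itself
  is connected. Existence, equal size and exchange of trees then come from linear algebra.\<close>

lemma spanning_trees_eq_bases:
  "spanning_trees E = {T. T \<subseteq> E \<and> independent (b ` T) \<and> span (b ` T) = span (b ` E)}"
proof -
  have conn: "connected_graph T \<longleftrightarrow> span (b ` T) = span (b ` E)" if T: "T \<subseteq> E" for T
  proof -
    have conn_span: "connected_graph F \<longleftrightarrow> (\<forall>x y. axis x 1 - axis y 1 \<in> span (b ` F))"
      if "F \<subseteq> E" for F
      unfolding connected_graph_def reach_def[symmetric] axis_diff_in_span_iff[OF that] ..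
    show ?thesis
    proof
      assume "connected_graph T"
      then have "axis x 1 - axis y 1 \<in> span (b ` T)" for x y
        using conn_span[OF T] by blast
      then have "b ` E \<subseteq> span (b ` T)"
        by (simp add: image_subset_iff edge_vec_def)
      with image_mono[OF T] show "span (b ` T) = span (b ` E)"
        by (rule span_eq_if_spanning_subset)
    next
      assume "span (b ` T) = span (b ` E)"
      then show "connected_graph T"
        unfolding conn_span[OF T] using connected[unfolded conn_span[OF subset_refl]] by (simp only: simp_thms)
    qed
  qed
  have tree: "tree_graph T \<longleftrightarrow> span (b ` T) = span (b ` E) \<and> independent (b ` T)" if T: "T \<subseteq> E" for T
  proof -
    have "simple_graph T" using simple T unfolding simple_graph_def by blast
    then show ?thesis
      unfolding tree_graph_def conn[OF T] acyclic_iff_independent[OF T] by simp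
  qed
  show ?thesis
    unfolding spanning_trees_def
    by (rule Collect_cong, rule conj_cong[OF refl], subst tree, assumption, rule conj_commute)
qed

lemma spanning_tree_subset: "T \<in> spanning_trees E \<Longrightarrow> T \<subseteq> E"
  by (simp add: spanning_trees_def)

lemma card_spanning_tree:
  assumes "T \<in> spanning_trees E"
  shows "card T = dim (b ` E)"
proof -
  have T: "T \<subseteq> E" "independent (b ` T)" "span (b ` T) = span (b ` E)"
    using assms by (simp_all add: spanning_trees_eq_bases)
  have "card T = card (b ` T)"
    using inj_on_subset[OF edge_vec_inj T(1)] by (rule card_image[symmetric])
  also have "\<dots> = dim (b ` E)"
    using T by (intro dim_eq_card[symmetric])
  finally show ?thesis .
qed

lemma spanning_trees_nonempty: "spanning_trees E \<noteq> {}"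
proof -
  obtain B where B: "B \<subseteq> b ` E" "independent B" "b ` E \<subseteq> span B"
    by (rule maximal_independent_subset)
  obtain T where T: "T \<subseteq> E" "B = b ` T" using B(1) by (rule subset_imageE)
  have "span B = span (b ` E)"
    using B(1,3) by (rule span_eq_if_spanning_subset)
  then have "T \<in> spanning_trees E"
    using B(2) T unfolding spanning_trees_eq_bases by simp
  then show ?thesis by blast
qed

lemma potential_edge_same:
  assumes "F \<subseteq> E" "h \<in> F"
  shows "potential F g \<bullet> b h = 0"
  unfolding potential_def using assms by (rule indicator_reach_edge)

text \<open>The fundamental cuts of \<open>T\<close> form a dual family to its edge vectors:
  independence makes the removal of \<open>g\<close> separate its ends, and no other tree edge
  crosses.\<close>

lemma potential_tree_edge:
  assumes T: "T \<in> spanning_trees E" and "g \<in> T" "h \<in> T"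
  shows "potential (T - {g}) g \<bullet> b h = (if h = g then 1 else 0)"
proof (cases "h = g")
  case True
  have "(fst (ori g), snd (ori g)) \<notin> reach (T - {g})"
  proof -
    have "independent (b ` T)" using T by (simp add: spanning_trees_eq_bases)
    then show ?thesis
      using assms(2) independent_edge_vecs_iff[OF spanning_tree_subset[OF T]] by blast
  qed
  then show ?thesis
    by (simp add: True potential_def inner_indicator_vec_edge_vec reach_def)
next
  case False
  then have "T - {g} \<subseteq> E" "h \<in> T - {g}"
    using assms(3) spanning_tree_subset[OF T] by auto
  then show ?thesis using False by (simp add: potential_edge_same)
qed

text \<open>Both sides are linear in \<open>x\<close> and agree on the edge vectors of
  \<open>T\<close> by duality.\<close>

lemma spanning_tree_expansion:
  assumes T: "T \<in> spanning_trees E" and x: "x \<in> span (b ` E)"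
  shows "(\<Sum>g\<in>T. (potential (T - {g}) g \<bullet> x) *\<^sub>R b g) = x"
proof -
  let ?f = "\<lambda>x. \<Sum>g\<in>T. (potential (T - {g}) g \<bullet> x) *\<^sub>R b g"
  have lin: "linear ?f"
    by (intro linear_compose_sum ballI linearI) (auto simp: inner_add_right algebra_simps)
  have fb: "?f (b h) = b h" if h: "h \<in> T" for h
  proof -
    have "?f (b h) = (\<Sum>g\<in>T. if g = h then b g else 0)"
      using h by (intro sum.cong) (auto simp: potential_tree_edge[OF T])
    then show ?thesis using h by simp
  qed
  have "x \<in> span (b ` T)" using T x by (simp add: spanning_trees_eq_bases)
  then have "?f x = id x"
    by (rule linear_eq_on[OF lin linear_id]) (use fb in force)
  then show ?thesis by simp
qed

subsection \<open>The tree potential\<close>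

text \<open>These are two-component spanning forests, not complements of trees. Indexing by the
  forest lets one \<open>F\<close> serve several edges, which the exchange requires.\<close>

definition cotrees :: "'n set \<Rightarrow> 'n set set set" where
  "cotrees g = {F. g \<notin> F \<and> insert g F \<in> spanning_trees E}"

text \<open>For \<open>F \<in> cotrees g\<close>, the number \<open>potential F g \<bullet> b e\<close> is the coefficient of \<open>b g\<close> in the
  expansion of \<open>b e\<close> along the tree \<open>insert g F\<close>. Exchanging \<open>g\<close> for \<open>e\<close> inverts this
  coefficient, and the inverse is the coefficient itself because it lies in \<open>{-1, 0, 1}\<close>.\<close>

lemma cotree_exchange:
  assumes F: "F \<in> cotrees g" and e: "e \<in> E" and nz: "potential F g \<bullet> b e \<noteq> 0"
  shows "F \<in> cotrees e" and "potential F e \<bullet> b g = potential F g \<bullet> b e"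
proof -
  have T: "insert g F \<in> spanning_trees E" and gF: "g \<notin> F"
    using F by (auto simp: cotrees_def)
  have FE: "F \<subseteq> E" and gE: "g \<in> E"
    using spanning_tree_subset[OF T] by auto
  have eF: "e \<notin> F" using potential_edge_same[OF FE] nz by blast
  \<comment> \<open>The potential annihilates the span of \<open>F\<close> but not
    \<open>b e\<close>.\<close>
  have "b e \<notin> span (b ` F)"
    using inner_eq_0_span[of "b ` F" "potential F g" "b e"] potential_edge_same[OF FE] nz by auto
  moreover have "independent (b ` F)"
    using T by (simp add: spanning_trees_eq_bases independent_insert split: if_splits)
  ultimately have ind: "independent (b ` insert e F)"
    by (simp add: independent_insertI)
  have "insert e F \<subseteq> E" using e FE by simp
  then have "card (b ` insert e F) = card (insert e F)"
    by (rule card_image[OF inj_on_subset[OF edge_vec_inj]])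
  also have "\<dots> = card (insert g F)" using eF gF by simp
  also have "\<dots> = dim (b ` E)" by (rule card_spanning_tree[OF T])
  finally have "b ` E \<subseteq> span (b ` insert e F)"
    using e FE ind by (intro card_ge_dim_independent) auto
  then have "span (b ` insert e F) = span (b ` E)"
    using e FE by (intro span_eq_if_spanning_subset image_mono) simp_all
  then have T': "insert e F \<in> spanning_trees E"
    using ind e FE by (simp add: spanning_trees_eq_bases)
  then show "F \<in> cotrees e" using eF by (simp add: cotrees_def)
  have "b e = (\<Sum>h\<in>insert g F. (potential (insert g F - {h}) h \<bullet> b e) *\<^sub>R b h)"
    using e by (intro spanning_tree_expansion[OF T, symmetric] span_base) auto
  \<comment> \<open>Pairing the expansion with \<open>potential F e\<close> kills all terms from
    \<open>F\<close> and leaves only \<open>h = g\<close>.\<close>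
  then have "potential F e \<bullet> b e
      = (\<Sum>h\<in>insert g F. (potential (insert g F - {h}) h \<bullet> b e) * (potential F e \<bullet> b h))"
    by (metis (no_types, lifting) inner_scaleR_right inner_sum_right sum.cong)
  also have "\<dots> = (potential F g \<bullet> b e) * (potential F e \<bullet> b g)"
    using gF potential_edge_same[OF FE] by simp
  also have "potential F e \<bullet> b e = 1"
    using potential_tree_edge[OF T', of e e] eF by simp
  finally have "(potential F g \<bullet> b e) * (potential F e \<bullet> b g) = 1" ..
  moreover have "potential F g \<bullet> b e \<in> {-1, 0, 1}"
    by (simp add: potential_def inner_indicator_vec_edge_vec)
  ultimately show "potential F e \<bullet> b g = potential F g \<bullet> b e" by auto
qed

text \<open>The weight omits \<open>w g\<close>, so it depends on the forest alone; this makes the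
  reciprocity below symmetric.\<close>

definition tree_potential :: "'n set \<Rightarrow> real^'n" where
  "tree_potential g = (\<Sum>F\<in>cotrees g. tree_weight w F *\<^sub>R potential F g)"

text \<open>Only forests completed to a tree by either edge contribute. For those, exchange equates
  the two pairings as soon as one is nonzero.\<close>

lemma tree_potential_reciprocity:
  assumes "e \<in> E" "g \<in> E"
  shows "tree_potential g \<bullet> b e = tree_potential e \<bullet> b g"
proof -
  have "tree_potential g \<bullet> b e
      = (\<Sum>F\<in>cotrees g \<inter> cotrees e. tree_weight w F * (potential F g \<bullet> b e))"
    if "e \<in> E" "g \<in> E" for e g
    unfolding tree_potential_def inner_sum_left inner_scaleR_left
    using cotree_exchange(1)[of _ g e] that by (intro sum.mono_neutral_right) auto
  moreover have "potential F g \<bullet> b e = potential F e \<bullet> b g"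
    if "F \<in> cotrees g \<inter> cotrees e" for F
    using cotree_exchange(2)[of F g e] cotree_exchange(2)[of F e g] that assms by fastforce
  ultimately show ?thesis
    using assms by (simp add: Int_commute)
qed

text \<open>The factor \<open>w g\<close> restores the weight of the whole tree, so the sum can run
  over trees through \<open>g\<close>.\<close>

lemma scaleR_tree_potential:
  "w g *\<^sub>R tree_potential g
    = (\<Sum>T\<in>{T \<in> spanning_trees E. g \<in> T}. tree_weight w T *\<^sub>R potential (T - {g}) g)"
  unfolding tree_potential_def scaleR_sum_right
  by (rule sum.reindex_bij_witness[of _ "\<lambda>T. T - {g}" "insert g"])
    (auto simp: cotrees_def insert_absorb tree_weight_def)

definition tree_total :: real where
  "tree_total = (\<Sum>T\<in>spanning_trees E. tree_weight w T)"

lemma tree_total_pos: "tree_total > 0"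
  unfolding tree_total_def tree_weight_def
  using spanning_trees_nonempty weight_pos spanning_tree_subset
  by (intro sum_pos prod_pos) auto

text \<open>Up to the factor \<open>tree_total\<close>, \<open>tree_potential e\<close> is the
  electrical potential of a unit current entering and leaving at the ends of \<open>e\<close>.
  Reciprocity and exchanging the sums over edges and trees turn the left side into a weighted sum of
  expansions of \<open>b e\<close>, one per tree.\<close>

lemma laplacian_tree_potential:
  assumes e: "e \<in> E"
  shows "laplacian E w ori *v tree_potential e = tree_total *\<^sub>R b e"
proof -
  have "laplacian E w ori *v tree_potential e
      = (\<Sum>g\<in>E. ((w g *\<^sub>R tree_potential g) \<bullet> b e) *\<^sub>R b g)"
    using tree_potential_reciprocity[OF e]
    by (simp add: laplacian_mult_vec inner_commute)
  also have "\<dots> = (\<Sum>g\<in>E. \<Sum>T\<in>{T \<in> spanning_trees E. g \<in> T}.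
      (tree_weight w T * (potential (T - {g}) g \<bullet> b e)) *\<^sub>R b g)"
    by (simp add: scaleR_tree_potential inner_sum_left scaleR_sum_left)
  also have "\<dots> = (\<Sum>T\<in>spanning_trees E. \<Sum>g\<in>{g \<in> E. g \<in> T}.
      (tree_weight w T * (potential (T - {g}) g \<bullet> b e)) *\<^sub>R b g)"
    by (rule sum.swap_restrict) auto
  also have "\<dots> = (\<Sum>T\<in>spanning_trees E. tree_weight w T *\<^sub>R b e)"
  proof (rule sum.cong[OF refl])
    fix T assume T: "T \<in> spanning_trees E"
    then have "{g \<in> E. g \<in> T} = T" using spanning_tree_subset by auto
    then show "(\<Sum>g\<in>{g \<in> E. g \<in> T}.
        (tree_weight w T * (potential (T - {g}) g \<bullet> b e)) *\<^sub>R b g) = tree_weight w T *\<^sub>R b e"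
      using spanning_tree_expansion[OF T span_base[of "b e"]] e
      by (simp flip: scaleR_scaleR scaleR_sum_right)
  qed
  finally show ?thesis by (simp add: tree_total_def scaleR_sum_left)
qed

section \<open>Marginals of tree distributions\<close>

lemma pmf_weighted_rst_eq:
  "pmf (weighted_rst E w) T
    = (if T \<in> spanning_trees E then tree_weight w T / tree_total else 0)"
  using pmf_weighted_rst[OF weight_pos spanning_trees_nonempty] by (simp add: tree_total_def)

lemma marginal_weighted_rst:
  assumes e: "e \<in> E"
  shows "marginal (weighted_rst E w) e = leverage E w ori e"
proof -
  have "marginal (weighted_rst E w) e
      = (\<Sum>T\<in>{T \<in> spanning_trees E. e \<in> T}. tree_weight w T / tree_total)"
    unfolding marginal_eq_sum by (intro sum.mono_neutral_cong_right) (auto simp: pmf_weighted_rst_eq)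
  \<comment> \<open>Each tree through \<open>e\<close> contributes exactly its weight, since its
    potential pairs with \<open>b e\<close> to 1.\<close>
  also have "\<dots> = (w e *\<^sub>R tree_potential e) \<bullet> b e / tree_total"
    unfolding scaleR_tree_potential inner_sum_left sum_divide_distrib
    by (intro sum.cong) (auto simp: potential_tree_edge)
  also have "\<dots> = leverage E w ori e"
    using leverage_eq_potential[OF _ laplacian_tree_potential[OF e]] weight_pos tree_total_pos
    by (simp add: less_imp_le)
  finally show ?thesis .
qed

text \<open>If no tree contained \<open>e\<close>, its tree potential would vanish, and the
  Laplacian equation would force \<open>b e = 0\<close>.\<close>

lemma marginal_weighted_rst_pos:
  assumes e: "e \<in> E"
  shows "marginal (weighted_rst E w) e > 0"
proof -
  have "cotrees e \<noteq> {}"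
  proof
    assume "cotrees e = {}"
    then have "tree_potential e = 0" by (simp add: tree_potential_def)
    then show False
      using laplacian_tree_potential[OF e] tree_total_pos edge_vec_nonzero[OF e] by simp
  qed
  then obtain T where T: "T \<in> spanning_trees E" "e \<in> T" by (auto simp: cotrees_def)
  have "tree_weight w T > 0"
    unfolding tree_weight_def using T(1) weight_pos spanning_tree_subset by (intro prod_pos) auto
  then have "0 < pmf (weighted_rst E w) T"
    using T tree_total_pos by (simp add: pmf_weighted_rst_eq)
  also have "\<dots> \<le> marginal (weighted_rst E w) e"
    unfolding marginal_eq_sum using T by (intro member_le_sum) auto
  finally show ?thesis .
qed

lemma admissible_weighted_rst: "admissible E (weighted_rst E w)"
  using marginal_weighted_rst_pos
  by (auto simp: admissible_def set_pmf_eq pmf_weighted_rst_eq split: if_splits)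

text \<open>Exchanging sums gives the expected number of tree edges, which is constant on the
  support.\<close>

lemma sum_marginal:
  assumes "set_pmf D \<subseteq> spanning_trees E"
  shows "(\<Sum>e\<in>E. marginal D e) = real (dim (b ` E))"
proof -
  have "(\<Sum>e\<in>E. marginal D e) = (\<Sum>T\<in>UNIV. \<Sum>e\<in>{e \<in> E. e \<in> T}. pmf D T)"
    using sum.swap_restrict[of E UNIV "\<lambda>e T. pmf D T" "\<lambda>e T. e \<in> T"]
    by (simp add: marginal_eq_sum)
  also have "\<dots> = (\<Sum>T\<in>UNIV. real (dim (b ` E)) * pmf D T)"
  proof (rule sum.cong[OF refl])
    fix T
    show "(\<Sum>e\<in>{e \<in> E. e \<in> T}. pmf D T) = real (dim (b ` E)) * pmf D T"
    proof (cases "T \<in> set_pmf D")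
      case True
      then have T: "T \<in> spanning_trees E" using assms by blast
      then have "{e \<in> E. e \<in> T} = T" using spanning_tree_subset by auto
      then show ?thesis using card_spanning_tree[OF T] by simp
    next
      case False
      then show ?thesis by (simp add: set_pmf_iff)
    qed
  qed
  also have "\<dots> = real (dim (b ` E))"
    by (simp add: sum_pmf_eq_1 flip: sum_distrib_left)
  finally show ?thesis .
qed

text \<open>Leverage scores are the marginals of one admissible distribution, so
  \<open>sum_marginal\<close> for two distributions replaces a trace computation.\<close>

lemma sum_leverage_eq_sum_marginal:
  assumes "admissible E D"
  shows "(\<Sum>e\<in>E. leverage E w ori e) = (\<Sum>e\<in>E. marginal D e)"
proof -
  have "(\<Sum>e\<in>E. leverage E w ori e) = (\<Sum>e\<in>E. marginal (weighted_rst E w) e)"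
    by (simp add: marginal_weighted_rst)
  then show ?thesis
    using assms admissible_weighted_rst by (simp add: admissible_def sum_marginal)
qed

end

subsection \<open>Minimax optimality\<close>

lemma Max_ratio_ge_1:
  fixes p t :: "'a \<Rightarrow> real"
  assumes A: "finite A" "A \<noteq> {}" and pos: "\<And>x. x \<in> A \<Longrightarrow> p x > 0"
    and eq: "(\<Sum>x\<in>A. t x) = (\<Sum>x\<in>A. p x)"
  shows "1 \<le> Max ((\<lambda>x. t x / p x) ` A)"
    and "Max ((\<lambda>x. t x / p x) ` A) = 1 \<longleftrightarrow> (\<forall>x\<in>A. p x = t x)"
proof -
  have Max_le: "Max ((\<lambda>x. t x / p x) ` A) \<le> 1 \<longleftrightarrow> (\<forall>x\<in>A. t x \<le> p x)"
    using A pos by (simp add: pos_divide_le_eq)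
  show ge: "1 \<le> Max ((\<lambda>x. t x / p x) ` A)"
  proof (rule ccontr)
    assume "\<not> 1 \<le> Max ((\<lambda>x. t x / p x) ` A)"
    then have "t x < p x" if "x \<in> A" for x
      using A pos that by (simp add: not_le pos_divide_less_eq)
    then have "(\<Sum>x\<in>A. t x) < (\<Sum>x\<in>A. p x)"
      using A by (intro sum_strict_mono) auto
    then show False using eq by simp
  qed
  \<comment> \<open>A termwise inequality between families with equal sums leaves no slack.\<close>
  have "(\<forall>x\<in>A. t x \<le> p x) \<longleftrightarrow> (\<forall>x\<in>A. p x = t x)"
    using sum_mono_inv[OF eq _ _ A(1)] by fastforce
  then show "Max ((\<lambda>x. t x / p x) ` A) = 1 \<longleftrightarrow> (\<forall>x\<in>A. p x = t x)"
    using ge Max_le by linarith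
qed

text \<open>Having at least two vertices ensures that the \<open>Max\<close> in
  \<open>local_risk\<close> ranges over a nonempty set.\<close>

lemma connected_graph_nonempty:
  assumes "CARD('n::finite) \<ge> 2" "connected_graph (E :: 'n set set)"
  shows "E \<noteq> {}"
proof
  assume "E = {}"
  then have "u = v" for u v :: 'n
    using assms(2) by (simp add: connected_graph_def)
  then have "CARD('n) \<le> 1" by (simp add: card_le_Suc0_iff_eq)
  then show False using assms(1) by simp
qed

theorem theorem4p5:
  fixes E :: "'n::finite set set"
    and w :: "'n set \<Rightarrow> real"
    and ori :: "'n set \<Rightarrow> 'n \<times> 'n"
  assumes "CARD('n) \<ge> 2"
    and "simple_graph E"
    and "orientation E ori"
    and "\<And>e. e \<in> E \<Longrightarrow> w e > 0"
    and "connected_graph E"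
  shows "(\<forall>D. admissible E D \<longrightarrow>
            local_risk E w ori D \<ge> 1 \<and>
            (local_risk E w ori D = 1 \<longleftrightarrow> (\<forall>e\<in>E. marginal D e = leverage E w ori e)))
       \<and> (\<forall>e\<in>E. marginal (weighted_rst E w) e = leverage E w ori e)
       \<and> is_arg_min (local_risk E w ori) (admissible E) (weighted_rst E w)
       \<and> local_risk E w ori (weighted_rst E w) = 1"
proof -
  interpret weighted_graph E ori w
    using assms by unfold_locales
  have risk: "local_risk E w ori D = Max ((\<lambda>e. leverage E w ori e / marginal D e) ` E)" for D
    using weight_pos by (simp add: local_risk_eq_Max less_imp_le)
  have bound: "1 \<le> local_risk E w ori D"
    and eq_iff: "local_risk E w ori D = 1 \<longleftrightarrow> (\<forall>e\<in>E. marginal D e = leverage E w ori e)"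
    if "admissible E D" for D
    unfolding risk
    using that connected_graph_nonempty[OF assms(1,5)] sum_leverage_eq_sum_marginal[OF that]
    by (intro Max_ratio_ge_1; simp add: admissible_def)+
  have rst: "local_risk E w ori (weighted_rst E w) = 1"
    using eq_iff[OF admissible_weighted_rst] marginal_weighted_rst by simp
  then have "is_arg_min (local_risk E w ori) (admissible E) (weighted_rst E w)"
    using bound admissible_weighted_rst by (fastforce simp: is_arg_min_def not_less)
  then show ?thesis
    using bound eq_iff rst marginal_weighted_rst by blast
qed

end
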